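(* Let $\underline{P}_i$ be a coherent lower prevision on $\mathcal{L}(\mathcal{X}_i)$, with conjugate $\overline{P}_i$, for $i=1,\dots,n$. Let $\Omega=\mathcal{X}_1\times\dots\times\mathcal{X}_n$ carry the total preorder $\preceq$ induced by $Z(x_1,\dots,x_n)=\max_{i=1}^nZ_i(x_i)$, where each $Z_i:\mathcal{X}_i\to[0,1]$ is surjective, and let $\underline{F}_i(z)=\underline{P}_i(Z_i^{-1}([0,z]))$, $\overline{F}_i(z)=\overline{P}_i(Z_i^{-1}([0,z]))$ for $z\in[0,1]$. Consider any rule of combination $\odot$ of coherent lower and upper previsions, mapping the marginals $\underline{P}_1,\dots,\underline{P}_n$ to a joint coherent lower prevision $\bigodot_{i=1}^n\underline{P}_i$ on all gambles on $\Omega$, with conjugate upper prevision $\bigodot_{i=1}^n\overline{P}_i$. Suppose there are functions $\ell$ and $u$ for which $$\bigodot_{i=1}^n\underline{P}_i\Bigl(\prod_{i=1}^nA_i\Bigr)=\ell(\underline{P}_1(A_1),\dots,\underline{P}_n(A_n))\quad\text{and}\quad\bigodot_{i=1}^n\overline{P}_i\Bigl(\prod_{i=1}^nA_i\Bigr)=u(\overline{P}_1(A_1),\dots,\overline{P}_n(A_n))$$ for all $A_1\subseteq\mathcal{X}_1,\dots,A_n\subseteq\mathcal{X}_n$. Then the couple $(\underline{F},\overline{F})$ defined by $$\underline{F}(z)=\ell(\underline{F}_1(z),\dots,\underline{F}_n(z)),\qquad\overline{F}(z)=u(\overline{F}_1(z),\dots,\overline{F}_n(z))$$ is the least conservative p-box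 on $(\Omega,\preceq)$ whose natural extension $\underline{E}_{\underline{F},\overline{F}}$ is dominated by the combination $\bigodot_{i=1}^n\underline{P}_i$ of $\underline{P}_1,\dots,\underline{P}_n$.
   Context: $\mathcal{L}(\mathcal{X})$ denotes the set of gambles (bounded real functions) on a set $\mathcal{X}$; events are identified with their indicators. A lower prevision on all gambles on a set is coherent if $\underline{P}(f)\ge\inf f$, $\underline{P}(\lambda f)=\lambda\underline{P}(f)$, $\underline{P}(f+g)\ge\underline{P}(f)+\underline{P}(g)$ for all gambles $f,g$ and $\lambda\ge0$; its conjugate upper prevision is $\overline{P}(f)=-\underline{P}(-f)$. A linear prevision is a functional $Q$ on all gambles with $Q(f)\ge\inf f$ and $Q(f+g)=Q(f)+Q(g)$. The preorder on $\Omega$ is $x\preceq y$ iff $Z(x)\le Z(y)$; $x\prec y$ iff $Z(x)<Z(y)$. $Z$ maps onto $[0,1]$; $0_\Omega$, $1_\Omega$ are elements with $Z$-value $0$ and $1$. $[x,y]=\{v:x\preceq v\preceq y\}$, $(x,y]=\{v:x\prec v\preceq y\}$. A cumulative distribution function on $(\Omega,\preceq)$ is a map $F:\Omega\to[0,1]$, non-decreasing with respect to $\preceq$, with $F(1_\Omega)=1$; it is constant on the level sets of $Z$ and is identified with a function of $z=Z(x)\in[0,1]$. A p-box on $(\Omega,\preceq)$ is a pair $(\underline{F},\overline{F})$ of cumulative distribution functions with $\underline{F}\le\overline{F}$. Its natural extension $\underline{E}_{\underline{F},\overline{F}}$ is the pointwise smallest coherent lower prevision $\underline{E}$ on all gambles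 with $\underline{E}([0_\Omega,x])=\underline{F}(x)$ and $\underline{E}((y,1_\Omega])=1-\overline{F}(y)$ for all $x,y\in\Omega$; equivalently $\underline{E}(f)=\min Q(f)$ over all linear previsions $Q$ on $\mathcal{L}(\Omega)$ with $\underline{F}(z)\le Q(Z^{-1}([0,z]))\le\overline{F}(z)$ for all $z\in[0,1]$. "Dominated by $\underline{P}$" means $\underline{E}_{\underline{F},\overline{F}}(f)\le\underline{P}(f)$ for all gambles $f$ on $\Omega$. "Least conservative" means: the given pair is such a p-box, and every p-box $(\underline{G},\overline{G})$ on $(\Omega,\preceq)$ whose natural extension is dominated by $\underline{P}$ satisfies $\underline{G}\le\underline{F}$ and $\overline{G}\ge\overline{F}$ pointwise. *)

theory Defs
  imports Complex_Main "HOL-Library.FuncSet" "HOL-Library.Indicator_Function"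
begin

section \<open>Gambles and coherent lower previsions\<close>

text \<open>Spaces are carrier sets. A gamble on \<open>S\<close> is any function of the ambient type that is
  bounded on \<open>S\<close>; its values outside \<open>S\<close> are irrelevant.\<close>

definition gamble :: "'b set \<Rightarrow> ('b \<Rightarrow> real) \<Rightarrow> bool" where
  "gamble S f \<longleftrightarrow> (\<exists>B. \<forall>x\<in>S. \<bar>f x\<bar> \<le> B)"

text \<open>Since the infimum is taken over \<open>S\<close> only, a coherent \<open>P\<close> gives the same value to two
  gambles that agree on \<open>S\<close>: \<open>P f \<ge> P g + P (f - g) \<ge> P g\<close> and vice versa. So \<open>P\<close> is
  indeed a functional on the gambles on \<open>S\<close>.\<close>

definition coherent_lower :: "'b set \<Rightarrow> (('b \<Rightarrow> real) \<Rightarrow> real) \<Rightarrow> bool" where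
  "coherent_lower S P \<longleftrightarrow>
     (\<forall>f. gamble S f \<longrightarrow> P f \<ge> (INF x\<in>S. f x)) \<and>
     (\<forall>f c. gamble S f \<longrightarrow> c \<ge> 0 \<longrightarrow> P (\<lambda>x. c * f x) = c * P f) \<and>
     (\<forall>f g. gamble S f \<longrightarrow> gamble S g \<longrightarrow> P (\<lambda>x. f x + g x) \<ge> P f + P g)"

definition conjugate :: "(('b \<Rightarrow> real) \<Rightarrow> real) \<Rightarrow> ('b \<Rightarrow> real) \<Rightarrow> real" where
  "conjugate P f = - P (\<lambda>x. - f x)"


section \<open>P-boxes on a space preordered by a real function\<close>

text \<open>In this section \<open>\<Omega>\<close> carries the total preorder \<open>x \<preceq> y \<longleftrightarrow> Z x \<le> Z y\<close>, and \<open>Z\<close> maps \<open>\<Omega>\<close>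
  onto \<open>[0,1]\<close>. The elements written \<open>0\<^sub>\<Omega>\<close> and \<open>1\<^sub>\<Omega>\<close> in the literature are any \<open>b\<close>, \<open>t\<close> in \<open>\<Omega>\<close>
  with \<open>Z b = 0\<close> and \<open>Z t = 1\<close>; nothing below depends on their choice.\<close>

definition closed_ivl :: "'b set \<Rightarrow> ('b \<Rightarrow> real) \<Rightarrow> 'b \<Rightarrow> 'b \<Rightarrow> 'b set" where
  "closed_ivl \<Omega> Z x y = {v\<in>\<Omega>. Z x \<le> Z v \<and> Z v \<le> Z y}"

definition left_open_ivl :: "'b set \<Rightarrow> ('b \<Rightarrow> real) \<Rightarrow> 'b \<Rightarrow> 'b \<Rightarrow> 'b set" where
  "left_open_ivl \<Omega> Z x y = {v\<in>\<Omega>. Z x < Z v \<and> Z v \<le> Z y}"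

definition is_cdf :: "'b set \<Rightarrow> ('b \<Rightarrow> real) \<Rightarrow> ('b \<Rightarrow> real) \<Rightarrow> bool" where
  "is_cdf \<Omega> Z F \<longleftrightarrow>
     F \<in> \<Omega> \<rightarrow> {0..1} \<and>
     (\<forall>x\<in>\<Omega>. \<forall>y\<in>\<Omega>. Z x \<le> Z y \<longrightarrow> F x \<le> F y) \<and>
     (\<forall>t\<in>\<Omega>. Z t = 1 \<longrightarrow> F t = 1)"

definition is_pbox :: "'b set \<Rightarrow> ('b \<Rightarrow> real) \<Rightarrow> ('b \<Rightarrow> real) \<Rightarrow> ('b \<Rightarrow> real) \<Rightarrow> bool" where
  "is_pbox \<Omega> Z F F' \<longleftrightarrow> is_cdf \<Omega> Z F \<and> is_cdf \<Omega> Z F' \<and> (\<forall>x\<in>\<Omega>. F x \<le> F' x)"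

definition agrees_with_pbox ::
  "'b set \<Rightarrow> ('b \<Rightarrow> real) \<Rightarrow> ('b \<Rightarrow> real) \<Rightarrow> ('b \<Rightarrow> real) \<Rightarrow> (('b \<Rightarrow> real) \<Rightarrow> real) \<Rightarrow> bool" where
  "agrees_with_pbox \<Omega> Z F F' E \<longleftrightarrow>
     (\<forall>b\<in>\<Omega>. \<forall>t\<in>\<Omega>. Z b = 0 \<longrightarrow> Z t = 1 \<longrightarrow>
        (\<forall>x\<in>\<Omega>. E (indicator (closed_ivl \<Omega> Z b x)) = F x) \<and>
        (\<forall>y\<in>\<Omega>. E (indicator (left_open_ivl \<Omega> Z y t)) = 1 - F' y))"

definition is_natural_extension ::
  "'b set \<Rightarrow> ('b \<Rightarrow> real) \<Rightarrow> ('b \<Rightarrow> real) \<Rightarrow> ('b \<Rightarrow> real) \<Rightarrow> (('b \<Rightarrow> real) \<Rightarrow> real) \<Rightarrow> bool" where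
  "is_natural_extension \<Omega> Z F F' E \<longleftrightarrow>
     coherent_lower \<Omega> E \<and> agrees_with_pbox \<Omega> Z F F' E \<and>
     (\<forall>E'. coherent_lower \<Omega> E' \<longrightarrow> agrees_with_pbox \<Omega> Z F F' E' \<longrightarrow>
        (\<forall>f. gamble \<Omega> f \<longrightarrow> E f \<le> E' f))"

text \<open>The natural extension is determined on all gambles, its values on other functions being
  irrelevant; hence a predicate, and the definite description in
  ``the natural extension of \<open>(F, F')\<close> is dominated by \<open>P\<close>'' becomes an existential.\<close>

lemma is_natural_extension_unique:
  assumes "is_natural_extension \<Omega> Z F F' E\<^sub>1" "is_natural_extension \<Omega> Z F F' E\<^sub>2" "gamble \<Omega> f"
  shows "E\<^sub>1 f = E\<^sub>2 f"
  using assms unfolding is_natural_extension_def by (meson order_antisym)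

definition natural_extension_dominated_by ::
  "'b set \<Rightarrow> ('b \<Rightarrow> real) \<Rightarrow> ('b \<Rightarrow> real) \<Rightarrow> ('b \<Rightarrow> real) \<Rightarrow> (('b \<Rightarrow> real) \<Rightarrow> real) \<Rightarrow> bool" where
  "natural_extension_dominated_by \<Omega> Z F F' P \<longleftrightarrow>
     (\<exists>E. is_natural_extension \<Omega> Z F F' E \<and> (\<forall>f. gamble \<Omega> f \<longrightarrow> E f \<le> P f))"

definition least_conservative_dominated_pbox ::
  "'b set \<Rightarrow> ('b \<Rightarrow> real) \<Rightarrow> (('b \<Rightarrow> real) \<Rightarrow> real) \<Rightarrow> ('b \<Rightarrow> real) \<Rightarrow> ('b \<Rightarrow> real) \<Rightarrow> bool" where
  "least_conservative_dominated_pbox \<Omega> Z P F F' \<longleftrightarrow>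
     is_pbox \<Omega> Z F F' \<and> natural_extension_dominated_by \<Omega> Z F F' P \<and>
     (\<forall>G G'. is_pbox \<Omega> Z G G' \<longrightarrow> natural_extension_dominated_by \<Omega> Z G G' P \<longrightarrow>
        (\<forall>x\<in>\<Omega>. G x \<le> F x \<and> F' x \<le> G' x))"


section \<open>Marginals and their combination\<close>

definition lower_cdf :: "'a set \<Rightarrow> ('a \<Rightarrow> real) \<Rightarrow> (('a \<Rightarrow> real) \<Rightarrow> real) \<Rightarrow> real \<Rightarrow> real" where
  "lower_cdf S Z P z = P (indicator {x\<in>S. Z x \<in> {0..z}})"

definition upper_cdf :: "'a set \<Rightarrow> ('a \<Rightarrow> real) \<Rightarrow> (('a \<Rightarrow> real) \<Rightarrow> real) \<Rightarrow> real \<Rightarrow> real" where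
  "upper_cdf S Z P z = conjugate P (indicator {x\<in>S. Z x \<in> {0..z}})"

definition joint_Z :: "nat \<Rightarrow> (nat \<Rightarrow> 'a \<Rightarrow> real) \<Rightarrow> (nat \<Rightarrow> 'a) \<Rightarrow> real" where
  "joint_Z n Z x = (MAX i\<in>{1..n}. Z i (x i))"

text \<open>The spaces \<open>X 1, \<dots>, X n\<close> are arbitrary subsets of one ambient type (different types
  can be embedded into a common sum type); their product is the extensional function space.\<close>

definition combination_rule ::
  "nat \<Rightarrow> (nat \<Rightarrow> 'a set) \<Rightarrow>
   ((nat \<Rightarrow> ('a \<Rightarrow> real) \<Rightarrow> real) \<Rightarrow> ((nat \<Rightarrow> 'a) \<Rightarrow> real) \<Rightarrow> real) \<Rightarrow> bool" where
  "combination_rule n X C \<longleftrightarrow>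
     (\<forall>P. (\<forall>i\<in>{1..n}. coherent_lower (X i) (P i)) \<longrightarrow> coherent_lower (\<Pi>\<^sub>E i\<in>{1..n}. X i) (C P))"

end

theory Submission imports Defs begin

text \<open>The joint preorder is the one for which sublevel sets are boxes: \<open>max\<^sub>i Z\<^sub>i(x\<^sub>i) \<le> z\<close> holds iff
  every \<open>Z\<^sub>i(x\<^sub>i) \<le> z\<close>. Hence the factorization of the combination \<open>Q\<close> on product events says
  exactly that \<open>F\<close> and \<open>F'\<close> are the lower and the upper probability under \<open>Q\<close> of the
  sublevel sets (\<open>sublevel_joint_Z\<close>).

  What remains concerns a single coherent lower prevision \<open>Q\<close> on a space preordered by \<open>Z\<close>
  (\<open>least_conservative_dominated_pbox_sublevel\<close>). Coherence makes its lower and upper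
  probabilities of sublevel sets a p-box, with which \<open>Q\<close> itself agrees. So some coherent lower
  prevision agrees with the p-box, and the pointwise infimum of all those that do is again one:
  it is the natural extension, and it lies below \<open>Q\<close>. Conversely, if the natural
  extension of another p-box lies below \<open>Q\<close>, evaluating it on the sublevel sets and on their
  complements, where it reproduces that p-box, gives the two required inequalities.\<close>

section \<open>Coherent lower previsions\<close>

lemma gamble_indicator: "gamble S (indicator A)"
  unfolding gamble_def by (rule exI[of _ 1]) (auto simp: indicator_def)

lemma gamble_const: "gamble S (\<lambda>_. c)"
  unfolding gamble_def by blast

lemma gamble_mult:
  assumes "gamble S f"
  shows "gamble S (\<lambda>x. c * f x)"
proof -
  obtain B where "\<forall>x\<in>S. \<bar>f x\<bar> \<le> B" using assms unfolding gamble_def by blast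
  then have "\<forall>x\<in>S. \<bar>c * f x\<bar> \<le> \<bar>c\<bar> * B" by (simp add: abs_mult mult_left_mono)
  then show ?thesis unfolding gamble_def by blast
qed

lemma gamble_uminus: "gamble S f \<Longrightarrow> gamble S (\<lambda>x. - f x)"
  using gamble_mult[of S f "-1"] by simp

lemma gamble_add:
  assumes "gamble S f" "gamble S g"
  shows "gamble S (\<lambda>x. f x + g x)"
proof -
  obtain B B' where "\<forall>x\<in>S. \<bar>f x\<bar> \<le> B" "\<forall>x\<in>S. \<bar>g x\<bar> \<le> B'"
    using assms unfolding gamble_def by blast
  then have "\<forall>x\<in>S. \<bar>f x + g x\<bar> \<le> B + B'" by fastforce
  then show ?thesis unfolding gamble_def by blast
qed

lemma coherent_lower_ge_bound:
  assumes "coherent_lower S P" "S \<noteq> {}" "gamble S f" "\<And>x. x \<in> S \<Longrightarrow> c \<le> f x"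
  shows "c \<le> P f"
proof -
  have "c \<le> (INF x\<in>S. f x)" using assms(2,4) by (intro cINF_greatest) auto
  also have "\<dots> \<le> P f" using assms(1,3) unfolding coherent_lower_def by blast
  finally show ?thesis .
qed

lemma coherent_lower_mult:
  "coherent_lower S P \<Longrightarrow> gamble S f \<Longrightarrow> 0 \<le> c \<Longrightarrow> P (\<lambda>x. c * f x) = c * P f"
  unfolding coherent_lower_def by blast

lemma coherent_lower_superadditive:
  "coherent_lower S P \<Longrightarrow> gamble S f \<Longrightarrow> gamble S g \<Longrightarrow> P f + P g \<le> P (\<lambda>x. f x + g x)"
  unfolding coherent_lower_def by blast

text \<open>Superadditivity splits \<open>g\<close> as \<open>f + (g - f)\<close>, where the second summand has a nonnegative infimum.\<close>

lemma coherent_lower_mono: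
  assumes P: "coherent_lower S P" "S \<noteq> {}" and f: "gamble S f" and g: "gamble S g"
    and le: "\<And>x. x \<in> S \<Longrightarrow> f x \<le> g x"
  shows "P f \<le> P g"
proof -
  have d: "gamble S (\<lambda>x. g x + - f x)" using f g by (intro gamble_add gamble_uminus)
  have "0 \<le> P (\<lambda>x. g x + - f x)"
    using le by (intro coherent_lower_ge_bound[OF P d]) fastforce
  moreover have "P f + P (\<lambda>x. g x + - f x) \<le> P (\<lambda>x. f x + (g x + - f x))"
    by (rule coherent_lower_superadditive[OF P(1) f d])
  ultimately show ?thesis by simp
qed

lemma coherent_lower_cong:
  assumes "coherent_lower S P" "S \<noteq> {}" "gamble S f" "gamble S g" "\<And>x. x \<in> S \<Longrightarrow> f x = g x"
  shows "P f = P g"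
  using assms coherent_lower_mono[of S P f g] coherent_lower_mono[of S P g f] by fastforce

text \<open>Superadditivity for \<open>f\<close> and \<open>- f\<close>, whose sum has value \<open>0\<close>.\<close>

lemma coherent_lower_le_conjugate:
  assumes P: "coherent_lower S P" and f: "gamble S f"
  shows "P f \<le> conjugate P f"
proof -
  have "P (\<lambda>_. 0) = 0"
    using coherent_lower_mult[OF P gamble_const[of S 0], of 0] by simp
  with coherent_lower_superadditive[OF P f gamble_uminus[OF f]] show ?thesis
    by (simp add: conjugate_def)
qed

lemma conjugate_le_bound:
  assumes "coherent_lower S P" "S \<noteq> {}" "gamble S f" "\<And>x. x \<in> S \<Longrightarrow> f x \<le> c"
  shows "conjugate P f \<le> c"
  using coherent_lower_ge_bound[OF assms(1,2) gamble_uminus[OF assms(3)], of "- c"] assms(4)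
  unfolding conjugate_def by force

lemma conjugate_mono:
  assumes "coherent_lower S P" "S \<noteq> {}" "gamble S f" "gamble S g" "\<And>x. x \<in> S \<Longrightarrow> f x \<le> g x"
  shows "conjugate P f \<le> conjugate P g"
  using coherent_lower_mono[OF assms(1,2) gamble_uminus[OF assms(4)] gamble_uminus[OF assms(3)]]
    assms(5) unfolding conjugate_def by simp

lemma coherent_lower_add_const:
  assumes P: "coherent_lower S P" "S \<noteq> {}" and f: "gamble S f"
  shows "P (\<lambda>x. f x + c) = P f + c"
proof -
  have ge: "P f + c \<le> P (\<lambda>x. f x + c)" if f: "gamble S f" for f and c
  proof -
    have "c \<le> P (\<lambda>_. c)" by (rule coherent_lower_ge_bound[OF P gamble_const]) simp
    with coherent_lower_superadditive[OF P(1) f gamble_const, of c] show ?thesis by simp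
  qed
  \<comment> \<open>The reverse inequality is the same one, for translation by \<open>- c\<close>.\<close>
  from ge[OF f, of c] ge[OF gamble_add[OF f gamble_const], of c "- c"] show ?thesis by simp
qed

text \<open>The intervals \<open>(y, 1]\<close> are complements of sublevel sets, so this turns the condition that a
  p-box puts on them into one on the upper probability of sublevel sets.\<close>

lemma coherent_lower_Diff:
  assumes P: "coherent_lower S P" "S \<noteq> {}"
  shows "P (indicator (S - A)) = 1 - conjugate P (indicator A)"
proof -
  \<comment> \<open>The two functions differ off \<open>S\<close>, hence the appeal to congruence.\<close>
  have "P (indicator (S - A)) = P (\<lambda>x. - indicator A x + 1)"
    by (rule coherent_lower_cong[OF P gamble_indicator
          gamble_add[OF gamble_uminus[OF gamble_indicator] gamble_const]])
       (auto simp: indicator_def)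
  also have "\<dots> = 1 - conjugate P (indicator A)"
    unfolding coherent_lower_add_const[OF P gamble_uminus[OF gamble_indicator]] conjugate_def
    by simp
  finally show ?thesis .
qed

text \<open>The common lower bound \<open>inf f\<close> that coherence imposes is what makes the infimum over \<open>\<P>\<close>
  a genuine one.\<close>

lemma coherent_lower_INF_le:
  assumes "\<And>P. P \<in> \<P> \<Longrightarrow> coherent_lower S P" "gamble S f" "P \<in> \<P>"
  shows "(INF P\<in>\<P>. P f) \<le> P f"
proof -
  have "\<forall>P\<in>\<P>. (INF x\<in>S. f x) \<le> P f" using assms(1,2) unfolding coherent_lower_def by blast
  then have "bdd_below ((\<lambda>P. P f) ` \<P>)" by (auto intro: bdd_belowI)
  then show ?thesis using assms(3) by (rule cINF_lower)
qed

lemma cINF_eq_const: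
  fixes c :: "'c :: conditionally_complete_lattice"
  assumes "I \<noteq> {}" "\<And>i. i \<in> I \<Longrightarrow> f i = c"
  shows "(INF i\<in>I. f i) = c"
proof -
  have "f ` I = {c}" using assms by force
  then show ?thesis by simp
qed

text \<open>Each axiom bounds the value of every member of \<open>\<P>\<close> from below, and passes to the
  infimum; homogeneity is an equality, but for \<open>c > 0\<close> its upper half is the lower half for
  the gamble \<open>c f\<close> and the factor \<open>1 / c\<close>.\<close>

lemma coherent_lower_INF:
  assumes ne: "\<P> \<noteq> {}" and S: "S \<noteq> {}" and coh: "\<And>P. P \<in> \<P> \<Longrightarrow> coherent_lower S P"
  shows "coherent_lower S (\<lambda>f. INF P\<in>\<P>. P f)"
proof -
  define E where "E f = (INF P\<in>\<P>. P f)" for f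
  have low: "E f \<le> P f" if "gamble S f" "P \<in> \<P>" for f P
    unfolding E_def using coh that by (rule coherent_lower_INF_le)
  have greatest: "c \<le> E f" if "\<And>P. P \<in> \<P> \<Longrightarrow> c \<le> P f" for c f
    unfolding E_def using ne that by (rule cINF_greatest)
  have scale: "c * E f \<le> E (\<lambda>x. c * f x)" if f: "gamble S f" and c: "0 \<le> c" for f c
  proof (rule greatest)
    fix P assume P: "P \<in> \<P>"
    show "c * E f \<le> P (\<lambda>x. c * f x)"
      unfolding coherent_lower_mult[OF coh[OF P] f c] using low[OF f P] c by (rule mult_left_mono)
  qed
  have "coherent_lower S E"
    unfolding coherent_lower_def
  proof (intro conjI allI impI)
    fix f assume "gamble S f"
    then show "(INF x\<in>S. f x) \<le> E f"
      using coh unfolding coherent_lower_def by (intro greatest) blast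
  next
    fix f and c :: real assume f: "gamble S f" and c: "0 \<le> c"
    show "E (\<lambda>x. c * f x) = c * E f"
    proof (cases "c = 0")
      case True
      have "P (\<lambda>x. 0) = 0" if "P \<in> \<P>" for P
        using coherent_lower_mult[OF coh[OF that] f, of 0] by simp
      with True ne show ?thesis by (simp add: E_def cINF_eq_const)
    next
      case False
      with c have "0 < c" by simp
      with scale[OF gamble_mult[OF f], of "1 / c" c] have "E (\<lambda>x. c * f x) \<le> c * E f"
        by (simp add: field_simps)
      with scale[OF f c] show ?thesis by simp
    qed
  next
    fix f g assume f: "gamble S f" and g: "gamble S g"
    show "E f + E g \<le> E (\<lambda>x. f x + g x)"
    proof (rule greatest)
      fix P assume P: "P \<in> \<P>"
      show "E f + E g \<le> P (\<lambda>x. f x + g x)"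
        using low[OF f P] low[OF g P] coherent_lower_superadditive[OF coh[OF P] f g] by simp
    qed
  qed
  then show ?thesis unfolding E_def .
qed

section \<open>The p-box of a coherent lower prevision\<close>

text \<open>The natural extension is the lower envelope of the coherent lower previsions that agree
  with the p-box; \<open>Q\<close> is there to make this family nonempty.\<close>

lemma natural_extension_dominated_by_agreeing:
  assumes Q: "coherent_lower \<Omega> Q" "agrees_with_pbox \<Omega> Z F F' Q" and ne: "\<Omega> \<noteq> {}"
  shows "natural_extension_dominated_by \<Omega> Z F F' Q"
proof -
  define \<P> where "\<P> = {P. coherent_lower \<Omega> P \<and> agrees_with_pbox \<Omega> Z F F' P}"
  define E where "E f = (INF P\<in>\<P>. P f)" for f
  have QP: "Q \<in> \<P>" using Q by (simp add: \<P>_def)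
  have low: "E f \<le> P f" if "gamble \<Omega> f" "P \<in> \<P>" for f P
    unfolding E_def using that by (intro coherent_lower_INF_le) (auto simp: \<P>_def)
  have const: "E f = c" if "\<And>P. P \<in> \<P> \<Longrightarrow> P f = c" for f c
    unfolding E_def using QP that by (intro cINF_eq_const) auto
  have "coherent_lower \<Omega> E"
    unfolding E_def using QP ne by (intro coherent_lower_INF) (auto simp: \<P>_def)
  moreover have "agrees_with_pbox \<Omega> Z F F' E"
    unfolding agrees_with_pbox_def by (auto intro!: const simp: \<P>_def agrees_with_pbox_def)
  ultimately have "is_natural_extension \<Omega> Z F F' E"
    using low unfolding is_natural_extension_def \<P>_def by blast
  then show ?thesis
    using low QP unfolding natural_extension_dominated_by_def by blast
qed

lemma closed_ivl_bottom:
  assumes "Z ` \<Omega> \<subseteq> {0..1}" "Z b = 0"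
  shows "closed_ivl \<Omega> Z b x = {v\<in>\<Omega>. Z v \<le> Z x}"
  using assms by (auto simp: closed_ivl_def)

lemma left_open_ivl_top:
  assumes "Z ` \<Omega> \<subseteq> {0..1}" "Z t = 1"
  shows "left_open_ivl \<Omega> Z y t = \<Omega> - {v\<in>\<Omega>. Z v \<le> Z y}"
  using assms by (auto simp: left_open_ivl_def)

text \<open>The scale must attain both its ends: agreement with a p-box constrains the intervals that
  start at a bottom and those that end at a top element. Without such elements it is vacuous and
  says nothing about how a dominated p-box compares with \<open>Q\<close>.\<close>

theorem least_conservative_dominated_pbox_sublevel:
  assumes Q: "coherent_lower \<Omega> Q"
    and Z: "Z ` \<Omega> \<subseteq> {0..1}" "0 \<in> Z ` \<Omega>" "1 \<in> Z ` \<Omega>"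
    and F: "\<And>x. x \<in> \<Omega> \<Longrightarrow> F x = Q (indicator {v\<in>\<Omega>. Z v \<le> Z x})"
    and F': "\<And>x. x \<in> \<Omega> \<Longrightarrow> F' x = conjugate Q (indicator {v\<in>\<Omega>. Z v \<le> Z x})"
  shows "least_conservative_dominated_pbox \<Omega> Z Q F F'"
proof -
  have ne: "\<Omega> \<noteq> {}" using Z by auto
  obtain b t where bt: "b \<in> \<Omega>" "Z b = 0" "t \<in> \<Omega>" "Z t = 1" using Z by auto
  define L :: "_ \<Rightarrow> _ \<Rightarrow> real" where "L x = indicator {v\<in>\<Omega>. Z v \<le> Z x}" for x
  have g: "gamble \<Omega> (L x)" for x unfolding L_def by (rule gamble_indicator)
  note bounds = coherent_lower_ge_bound[OF Q ne g] conjugate_le_bound[OF Q ne g]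
    coherent_lower_le_conjugate[OF Q g]
  have FL: "F x = Q (L x)" "F' x = conjugate Q (L x)" if "x \<in> \<Omega>" for x
    using that F F' by (simp_all add: L_def)
  have range: "0 \<le> Q (L x)" "Q (L x) \<le> conjugate Q (L x)" "conjugate Q (L x) \<le> 1" for x
    by (intro bounds; simp add: L_def)+
  note range = range order_trans[OF range(1,2)] order_trans[OF range(2,3)]
  have mono: "Q (L x) \<le> Q (L y)" "conjugate Q (L x) \<le> conjugate Q (L y)" if "Z x \<le> Z y" for x y
    using that by (intro coherent_lower_mono[OF Q ne g g] conjugate_mono[OF Q ne g g];
      auto simp: L_def indicator_def)+
  have top: "1 \<le> Q (L x)" if "Z x = 1" for x
    using that Z(1) by (intro bounds) (auto simp: L_def indicator_def)
  have "is_pbox \<Omega> Z F F'"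
    unfolding is_pbox_def is_cdf_def
  proof (intro conjI ballI impI)
    show "F \<in> \<Omega> \<rightarrow> {0..1}" "F' \<in> \<Omega> \<rightarrow> {0..1}"
      using range by (simp_all add: FL)
  qed (use mono range top in \<open>auto simp: FL intro!: antisym order_trans[OF top range(2)]\<close>)
  moreover have agree: "agrees_with_pbox \<Omega> Z F F' Q"
    unfolding agrees_with_pbox_def
    by (auto simp: closed_ivl_bottom[OF Z(1)] left_open_ivl_top[OF Z(1)] F F'
        coherent_lower_Diff[OF Q ne])
  moreover have "G x \<le> F x \<and> F' x \<le> G' x"
    if dom: "natural_extension_dominated_by \<Omega> Z G G' Q" and x: "x \<in> \<Omega>" for G G' x
  proof -
    obtain E where E: "agrees_with_pbox \<Omega> Z G G' E" "\<And>f. gamble \<Omega> f \<Longrightarrow> E f \<le> Q f"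
      using dom unfolding natural_extension_dominated_by_def is_natural_extension_def by blast
    have "E (indicator (closed_ivl \<Omega> Z b x)) = G x" "Q (indicator (closed_ivl \<Omega> Z b x)) = F x"
      "E (indicator (left_open_ivl \<Omega> Z x t)) = 1 - G' x"
      "Q (indicator (left_open_ivl \<Omega> Z x t)) = 1 - F' x"
      using E(1) agree bt x unfolding agrees_with_pbox_def by blast+
    then show ?thesis
      using E(2)[OF gamble_indicator, of "closed_ivl \<Omega> Z b x"]
        E(2)[OF gamble_indicator, of "left_open_ivl \<Omega> Z x t"] by simp
  qed
  ultimately show ?thesis
    using natural_extension_dominated_by_agreeing[OF Q agree ne]
    unfolding least_conservative_dominated_pbox_def by blast
qed

section \<open>The maximum as joint scale\<close>

lemma joint_Z_le_iff:
  assumes "n \<ge> 1"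
  shows "joint_Z n Z x \<le> z \<longleftrightarrow> (\<forall>i\<in>{1..n}. Z i (x i) \<le> z)"
  using assms unfolding joint_Z_def by (subst Max_le_iff) auto

lemma joint_Z_in:
  assumes "n \<ge> 1" "\<And>i. i \<in> {1..n} \<Longrightarrow> Z i (x i) \<in> A"
  shows "joint_Z n Z x \<in> A"
proof -
  have "joint_Z n Z x \<in> (\<lambda>i. Z i (x i)) ` {1..n}"
    unfolding joint_Z_def using assms(1) by (intro Max_in) auto
  with assms(2) show ?thesis by auto
qed

lemma sublevel_joint_Z:
  assumes "n \<ge> 1" "\<And>i. i \<in> {1..n} \<Longrightarrow> Z i ` X i \<subseteq> {0..1}"
  shows "{x \<in> \<Pi>\<^sub>E i\<in>{1..n}. X i. joint_Z n Z x \<le> z} = (\<Pi>\<^sub>E i\<in>{1..n}. {a\<in>X i. Z i a \<in> {0..z}})"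
proof -
  have "0 \<le> Z i a" if "i \<in> {1..n}" "a \<in> X i" for i a using assms(2)[OF that(1)] that(2) by auto
  then show ?thesis
    unfolding joint_Z_le_iff[OF assms(1)] by (fastforce simp: PiE_iff)
qed

text \<open>On a diagonal-like point, with every coordinate at level \<open>z\<close>, the maximum is \<open>z\<close>.\<close>

lemma joint_Z_onto:
  assumes "n \<ge> 1" "\<And>i. i \<in> {1..n} \<Longrightarrow> z \<in> Z i ` X i"
  shows "z \<in> joint_Z n Z ` (\<Pi>\<^sub>E i\<in>{1..n}. X i)"
proof -
  have "\<forall>i\<in>{1..n}. \<exists>a. a \<in> X i \<and> Z i a = z" using assms(2) by blast
  then obtain a where a: "\<forall>i\<in>{1..n}. a i \<in> X i \<and> Z i (a i) = z" by metis
  have "joint_Z n Z (restrict a {1..n}) \<in> {z}"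
    using a by (intro joint_Z_in[OF assms(1)]) auto
  then have "joint_Z n Z (restrict a {1..n}) = z" by simp
  moreover have "restrict a {1..n} \<in> (\<Pi>\<^sub>E i\<in>{1..n}. X i)" using a by auto
  ultimately show ?thesis by blast
qed

theorem lemma22:
  fixes n :: nat
    and X :: "nat \<Rightarrow> 'a set"
    and Z :: "nat \<Rightarrow> 'a \<Rightarrow> real"
    and P :: "nat \<Rightarrow> ('a \<Rightarrow> real) \<Rightarrow> real"
    and C :: "(nat \<Rightarrow> ('a \<Rightarrow> real) \<Rightarrow> real) \<Rightarrow> ((nat \<Rightarrow> 'a) \<Rightarrow> real) \<Rightarrow> real"
    and l u :: "(nat \<Rightarrow> real) \<Rightarrow> real"
  assumes "n \<ge> 1"
    and "\<And>i. i \<in> {1..n} \<Longrightarrow> coherent_lower (X i) (P i)"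
    and "\<And>i. i \<in> {1..n} \<Longrightarrow> Z i ` X i = {0..1}"
    and "combination_rule n X C"
    and "\<And>A. (\<And>i. i \<in> {1..n} \<Longrightarrow> A i \<subseteq> X i) \<Longrightarrow>
           C P (indicator (\<Pi>\<^sub>E i\<in>{1..n}. A i)) = l (\<lambda>i\<in>{1..n}. P i (indicator (A i)))"
    and "\<And>A. (\<And>i. i \<in> {1..n} \<Longrightarrow> A i \<subseteq> X i) \<Longrightarrow>
           conjugate (C P) (indicator (\<Pi>\<^sub>E i\<in>{1..n}. A i)) =
             u (\<lambda>i\<in>{1..n}. conjugate (P i) (indicator (A i)))"
  shows "least_conservative_dominated_pbox (\<Pi>\<^sub>E i\<in>{1..n}. X i) (joint_Z n Z) (C P)
           (\<lambda>x. l (\<lambda>i\<in>{1..n}. lower_cdf (X i) (Z i) (P i) (joint_Z n Z x)))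
           (\<lambda>x. u (\<lambda>i\<in>{1..n}. upper_cdf (X i) (Z i) (P i) (joint_Z n Z x)))"
proof (rule least_conservative_dominated_pbox_sublevel)
  show "coherent_lower (\<Pi>\<^sub>E i\<in>{1..n}. X i) (C P)"
    using assms(2,4) unfolding combination_rule_def by blast
  show "joint_Z n Z ` (\<Pi>\<^sub>E i\<in>{1..n}. X i) \<subseteq> {0..1}"
  proof (intro image_subsetI joint_Z_in[OF assms(1)])
    fix x i assume "x \<in> (\<Pi>\<^sub>E i\<in>{1..n}. X i)" "i \<in> {1..n}"
    then show "Z i (x i) \<in> {0..1}" using assms(3) by blast
  qed
  show "0 \<in> joint_Z n Z ` (\<Pi>\<^sub>E i\<in>{1..n}. X i)" "1 \<in> joint_Z n Z ` (\<Pi>\<^sub>E i\<in>{1..n}. X i)"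
    using assms(3) by (intro joint_Z_onto[OF assms(1)]; simp)+
next
  fix x
  have sublevel: "{v \<in> \<Pi>\<^sub>E i\<in>{1..n}. X i. joint_Z n Z v \<le> joint_Z n Z x} =
      (\<Pi>\<^sub>E i\<in>{1..n}. {a\<in>X i. Z i a \<in> {0..joint_Z n Z x}})"
    using assms(1,3) by (intro sublevel_joint_Z) auto
  show "l (\<lambda>i\<in>{1..n}. lower_cdf (X i) (Z i) (P i) (joint_Z n Z x)) =
      C P (indicator {v \<in> \<Pi>\<^sub>E i\<in>{1..n}. X i. joint_Z n Z v \<le> joint_Z n Z x})"
    unfolding sublevel lower_cdf_def by (rule assms(5)[symmetric]) auto
  show "u (\<lambda>i\<in>{1..n}. upper_cdf (X i) (Z i) (P i) (joint_Z n Z x)) =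
      conjugate (C P) (indicator {v \<in> \<Pi>\<^sub>E i\<in>{1..n}. X i. joint_Z n Z v \<le> joint_Z n Z x})"
    unfolding sublevel upper_cdf_def by (rule assms(6)[symmetric]) auto
qed

end
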